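(* Let $K(x;\theta)=\theta e^{-\theta x}$, $x>0$, $\theta>0$, be the exponential kernel, let $\Pi$ be a prior on $\mathscr{M}(\mathbb{R}^+)$, and let $\Pi^*$ be the prior induced by $\Pi$ on densities via $P\mapsto f_P$, $f_P(x)=\int K(x;\theta)\,dP(\theta)$. If $f_0$ is a continuous density on $\mathbb{R}^+$, $x$ and $|\log f_0(x)|$ are $f_0$-integrable, $\bar F_0(x)=1-F_0(x)$ is completely monotone, where $F_0$ is the distribution function corresponding to $f_0$, and the weak support of $\Pi$ is $\mathscr{M}(\mathbb{R}^+)$, then $f_0\in\mathrm{KL}(\Pi^* )$.
   Context: $\mathbb{R}^+=(0,\infty)$. A function $\varphi$ on $\mathbb{R}^+$ is completely monotone if it possesses derivatives $\varphi^{(n)}$ of all orders and $(-1)^n\varphi^{(n)}(x)\ge0$ for $x>0$. A function $g$ is $f_0$-integrable if $\int|g|f_0<\infty$. $\mathscr{M}(S)$ is the set of probability measures on $S$; a prior is a probability measure on the indicated space; the weak support of a prior on $\mathscr{M}(S)$ is its support in the topology of weak convergence. $f_0\in\mathrm{KL}(\Pi^* )$ means $\Pi^*(\{f:\int f_0\log(f_0/f)<\epsilon\})>0$ for every $\epsilon>0$. *)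

theory Defs
  imports "HOL-Probability.Probability"
begin

abbreviation Rpos :: "real set" where
  "Rpos \<equiv> {0<..}"

subsection \<open>Priors on spaces of probability measures\<close>

definition prob_measures :: "'a::topological_space set \<Rightarrow> 'a measure set" where
  "prob_measures S = space (prob_algebra (restrict_space borel S))"

text \<open>The topology of weak convergence: the coarsest topology for which
  \<open>P \<mapsto> \<integral> g dP\<close> is continuous for every bounded continuous \<open>g\<close> on \<open>S\<close>.\<close>

definition weak_topology :: "'a::topological_space set \<Rightarrow> 'a measure topology" where
  "weak_topology S = topology_generated_by
     {{P \<in> prob_measures S. (LINT \<theta>|P. g \<theta>) \<in> U} | (g :: 'a \<Rightarrow> real) U.
        continuous_on S g \<and> bounded (g ` S) \<and> open U}"

definition weak_borel :: "'a::topological_space set \<Rightarrow> 'a measure measure" where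
  "weak_borel S = sigma (prob_measures S) {U. openin (weak_topology S) U}"

definition prior_on :: "'a::topological_space set \<Rightarrow> 'a measure measure \<Rightarrow> bool" where
  "prior_on S \<pi> \<longleftrightarrow> prob_space \<pi> \<and> sets \<pi> = sets (weak_borel S)"

definition weak_support :: "'a::topological_space set \<Rightarrow> 'a measure measure \<Rightarrow> 'a measure set" where
  "weak_support S \<pi> =
     {P \<in> prob_measures S. \<forall>U. openin (weak_topology S) U \<longrightarrow> P \<in> U \<longrightarrow> emeasure \<pi> U > 0}"

subsection \<open>Densities and induced priors\<close>

text \<open>Functions on \<open>S\<close> are represented by total functions on the reals; everything below
  depends only on their values on \<open>S\<close>. Densities are taken with respect to Lebesgue measure.\<close>

definition densities :: "real set \<Rightarrow> (real \<Rightarrow> real) set" where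
  "densities S = {f. f \<in> borel_measurable (restrict_space lborel S) \<and> (\<forall>x\<in>S. 0 \<le> f x) \<and>
     (\<integral>\<^sup>+x. ennreal (f x) \<partial>restrict_space lborel S) = 1}"

definition mixture :: "(real \<Rightarrow> 'a \<Rightarrow> real) \<Rightarrow> 'a measure \<Rightarrow> real \<Rightarrow> real" where
  "mixture K P x = (LINT \<theta>|P. K x \<theta>)"

text \<open>The image of \<open>\<pi>\<close> under \<open>P \<mapsto> f\<^sub>P\<close>. The densities carry the final \<open>\<sigma>\<close>-algebra of this map;
  for any other \<open>\<sigma>\<close>-algebra making the map measurable, the image measure is a restriction
  of this one.\<close>

definition induced_prior ::
    "(real \<Rightarrow> 'a \<Rightarrow> real) \<Rightarrow> real set \<Rightarrow> 'a measure measure \<Rightarrow> (real \<Rightarrow> real) measure" where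
  "induced_prior K S \<pi> =
     distr \<pi>
       (sigma (densities S) {A. A \<subseteq> densities S \<and> mixture K -` A \<inter> space \<pi> \<in> sets \<pi>})
       (mixture K)"

definition exp_kernel :: "real \<Rightarrow> real \<Rightarrow> real" where
  "exp_kernel x \<theta> = \<theta> * exp (- \<theta> * x)"

subsection \<open>Kullback--Leibler property\<close>

text \<open>The extended-real integral of \<open>f0 log (f0 / f)\<close> over \<open>S\<close>, with \<open>0 log (0 / y) = 0\<close> and
  \<open>x log (x / 0) = \<infinity>\<close> for \<open>x > 0\<close>. The Bochner integral would wrongly give \<open>0\<close> where the
  divergence is infinite. For densities the negative part always has a finite integral.\<close>

definition kl_integrand :: "(real \<Rightarrow> real) \<Rightarrow> (real \<Rightarrow> real) \<Rightarrow> real \<Rightarrow> ereal" where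
  "kl_integrand f0 f x =
     (if f0 x = 0 then 0 else if f x = 0 then \<infinity> else ereal (f0 x * ln (f0 x / f x)))"

definition kl_div :: "real set \<Rightarrow> (real \<Rightarrow> real) \<Rightarrow> (real \<Rightarrow> real) \<Rightarrow> ereal" where
  "kl_div S f0 f =
     enn2ereal (\<integral>\<^sup>+x. e2ennreal (kl_integrand f0 f x) \<partial>restrict_space lborel S) -
     enn2ereal (\<integral>\<^sup>+x. e2ennreal (- kl_integrand f0 f x) \<partial>restrict_space lborel S)"

definition KL :: "real set \<Rightarrow> (real \<Rightarrow> real) measure \<Rightarrow> (real \<Rightarrow> real) set" where
  "KL S \<pi>' = {f0. \<forall>\<epsilon>>0. emeasure \<pi>' {f \<in> space \<pi>'. kl_div S f0 f < ereal \<epsilon>} > 0}"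

subsection \<open>Conditions on the true density\<close>

definition density_integrable :: "real set \<Rightarrow> (real \<Rightarrow> real) \<Rightarrow> (real \<Rightarrow> real) \<Rightarrow> bool" where
  "density_integrable S f0 g \<longleftrightarrow> integrable (restrict_space lborel S) (\<lambda>x. \<bar>g x\<bar> * f0 x)"

definition distribution_function :: "(real \<Rightarrow> real) \<Rightarrow> real \<Rightarrow> real" where
  "distribution_function f0 x = (LINT t:{0<..x}|lborel. f0 t)"

definition completely_monotone :: "(real \<Rightarrow> real) \<Rightarrow> bool" where
  "completely_monotone \<phi> \<longleftrightarrow>
     (\<forall>n. \<forall>x>0. (deriv ^^ n) \<phi> field_differentiable (at x) \<and> (-1) ^ n * (deriv ^^ n) \<phi> x \<ge> 0)"

end

theory Submission
  imports Defs
begin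

text \<open>Write \<open>f\<^sub>P\<close> for \<open>mixture exp_kernel P\<close>. The survival function \<open>\<phi> = 1 - F\<^sub>0\<close> is completely
  monotone and \<open>f0 = - \<phi>'\<close>. By Bernstein's theorem \<open>f0\<close> would be an exponential mixture itself, but
  a one-sided and quantitative version is enough: for every \<open>n \<ge> 1\<close> there is a probability
  measure \<open>Q\<close> with \<open>f0 \<le> (1 + 1 / n) f\<^sub>Q\<close> on the whole half-line (\<open>exists_mixture_dominating\<close>). It
  can be read off from Taylor's formula at infinity,
  \<open>f0(x) = \<integral>\<^sub>x\<^sup>\<infinity> (- 1)\<^sup>n \<phi>\<^sup>(\<^sup>n\<^sup>+\<^sup>2\<^sup>)(s) (s - x)\<^sup>n / n! ds\<close>, because \<open>(s - x)\<^sup>n \<le> s\<^sup>n exp (- n x / s)\<close>, and the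
  total mass of the resulting mixing measure follows from \<open>\<integral> f0 = 1\<close> and Tonelli's theorem.
  Consequently \<open>\<integral> f0 log (f0 / f\<^sub>Q) \<le> log (1 + 1 / n)\<close> is as small as desired.

  It remains to pass from \<open>Q\<close> to a weak neighbourhood of \<open>Q\<close>, which has positive prior mass since
  \<open>Q\<close> lies in the weak support (\<open>kl_div_small_near_dominating_mixture\<close>). For fixed \<open>y > 0\<close> the
  function \<open>\<theta> \<mapsto> \<theta> exp (- \<theta> y)\<close> is bounded and continuous, so a neighbourhood can force
  \<open>f\<^sub>P(y)\<close> to be almost as large as \<open>f\<^sub>Q(y)\<close> for all \<open>y\<close> in a finite grid. As \<open>f\<^sub>P\<close> is decreasing, this
  gives a lower bound for \<open>f\<^sub>P\<close> on a compact interval (\<open>mixture_weak_lower_semicontinuous\<close>).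
  Outside it, the bound \<open>f\<^sub>P(x) \<ge> c exp (- 2 x / c)\<close>, valid as soon as \<open>f\<^sub>P(1) > c\<close>
  (\<open>mixture_lower_bound\<close>), bounds the integrand by \<open>f0\<close> times
  \<open>\<bar>log f0\<bar> + \<bar>log c\<bar> + 2 x / c\<close>, a product that the hypotheses make integrable.

  The set of mixing measures with small divergence must also be measurable. This holds because
  \<open>(P, x) \<mapsto> f\<^sub>P(x)\<close> is jointly measurable (\<open>borel_measurable_mixture_pair\<close>).\<close>

section \<open>Mixtures of exponential densities\<close>

lemma exp_kernel_pos: "0 < \<theta> \<Longrightarrow> 0 < exp_kernel x \<theta>"
  by (simp add: exp_kernel_def)

lemma exp_kernel_le:
  assumes "0 < \<theta>" "0 < x"
  shows "exp_kernel x \<theta> \<le> 1 / x"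
proof -
  have "\<theta> * x \<le> exp (\<theta> * x)"
    using exp_ge_add_one_self[of "\<theta> * x"] by linarith
  then show ?thesis
    using assms by (simp add: exp_kernel_def exp_minus field_simps)
qed

lemma exp_kernel_antimono: "0 < \<theta> \<Longrightarrow> x \<le> y \<Longrightarrow> exp_kernel y \<theta> \<le> exp_kernel x \<theta>"
  by (simp add: exp_kernel_def mult_left_mono)

lemma convex_on_exp_kernel:
  assumes "0 < \<theta>"
  shows "convex_on UNIV (\<lambda>x. exp_kernel x \<theta>)"
  unfolding exp_kernel_def
  by (rule f''_ge0_imp_convex[where f' = "\<lambda>x. - \<theta>\<^sup>2 * exp (- \<theta> * x)" and f'' = "\<lambda>x. \<theta>^3 * exp (- \<theta> * x)"])
    (use assms in \<open>auto intro!: derivative_eq_intros simp: power2_eq_square power3_eq_cube\<close>)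

lemma prob_measures_iff:
  "P \<in> prob_measures Rpos \<longleftrightarrow> sets P = sets (restrict_space borel Rpos) \<and> prob_space P"
  by (simp add: prob_measures_def space_prob_algebra)

lemma space_prob_measures:
  assumes "P \<in> prob_measures Rpos"
  shows "space P = Rpos"
  using sets_eq_imp_space_eq[of P "restrict_space borel Rpos"] assms
  by (simp add: prob_measures_iff space_restrict_space)

lemma measurable_prob_measures:
  assumes "P \<in> prob_measures Rpos"
  shows "borel_measurable P = borel_measurable (restrict_space borel Rpos)"
  using assms by (intro measurable_cong_sets) (auto simp: prob_measures_iff)

lemma measurable_restrict_lborel:
  "borel_measurable (restrict_space lborel S) = borel_measurable (restrict_space borel S)"
  by (rule measurable_cong_sets[OF sets_restrict_space_cong[OF sets_lborel] refl])

lemma measurable_exp_kernel [measurable]: "exp_kernel x \<in> borel_measurable borel"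
  unfolding exp_kernel_def by measurable

context
  fixes P :: "real measure"
  assumes P: "P \<in> prob_measures Rpos"
begin

interpretation P: prob_space P
  using P by (simp add: prob_measures_iff)

lemma integrable_exp_kernel:
  assumes "0 < x"
  shows "integrable P (exp_kernel x)"
proof (rule P.integrable_const_bound[where B = "1 / x"])
  show "AE \<theta> in P. norm (exp_kernel x \<theta>) \<le> 1 / x"
    using exp_kernel_le[OF _ assms] exp_kernel_pos[THEN less_imp_le]
    by (intro AE_I2) (auto simp: space_prob_measures[OF P])
  show "exp_kernel x \<in> borel_measurable P"
    unfolding measurable_prob_measures[OF P] by (rule measurable_restrict_space1) simp
qed

lemma mixture_pos:
  assumes "0 < x"
  shows "0 < mixture exp_kernel P x"
  unfolding mixture_def
  using integrable_exp_kernel[OF assms]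
  by (intro P.expectation_greater AE_I2) (auto simp: space_prob_measures[OF P] exp_kernel_pos)

lemma mixture_antimono:
  assumes "0 < x" "x \<le> y"
  shows "mixture exp_kernel P y \<le> mixture exp_kernel P x"
  unfolding mixture_def
  using assms by (intro integral_mono integrable_exp_kernel)
    (auto simp: space_prob_measures[OF P] exp_kernel_antimono)

lemma ennreal_mixture:
  assumes "0 < x"
  shows "ennreal (mixture exp_kernel P x) = (\<integral>\<^sup>+\<theta>. ennreal (exp_kernel x \<theta>) \<partial>P)"
  unfolding mixture_def
  using integrable_exp_kernel[OF assms]
  by (intro nn_integral_eq_integral[symmetric] AE_I2)
    (auto simp: space_prob_measures[OF P] exp_kernel_pos less_imp_le)

text \<open>Convexity in \<open>x\<close> passes from the kernel to the mixture, and finite convex functions on an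
  open interval are continuous.\<close>

lemma continuous_on_mixture: "continuous_on Rpos (mixture exp_kernel P)"
proof (rule convex_on_continuous)
  show "convex_on Rpos (mixture exp_kernel P)"
  proof (rule convex_onI)
    fix t x y :: real
    assume t: "0 < t" "t < 1" and xy: "x \<in> Rpos" "y \<in> Rpos"
    let ?z = "(1 - t) *\<^sub>R x + t *\<^sub>R y"
    have z: "0 < ?z"
      using t xy by (simp add: add_pos_pos)
    have "mixture exp_kernel P ?z \<le> (\<integral>\<theta>. (1 - t) * exp_kernel x \<theta> + t * exp_kernel y \<theta> \<partial>P)"
      unfolding mixture_def
    proof (rule integral_mono)
      fix \<theta> assume "\<theta> \<in> space P"
      then show "exp_kernel ?z \<theta> \<le> (1 - t) * exp_kernel x \<theta> + t * exp_kernel y \<theta>"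
        using convex_onD[OF convex_on_exp_kernel, of \<theta> t x y] t
        by (simp add: space_prob_measures[OF P])
    qed (use z xy in \<open>auto intro!: integrable_exp_kernel integrable_add integrable_mult_right\<close>)
    also have "\<dots> = (1 - t) * mixture exp_kernel P x + t * mixture exp_kernel P y"
      unfolding mixture_def using xy
      by (subst Bochner_Integration.integral_add)
        (auto intro!: integrable_exp_kernel integrable_mult_right)
    finally show "mixture exp_kernel P ?z
        \<le> (1 - t) * mixture exp_kernel P x + t * mixture exp_kernel P y" .
  qed simp
qed simp

text \<open>This bound makes the tails of the divergence integral uniformly small over a weak
  neighbourhood. It is Jensen's inequality for the probability measure proportional to
  \<open>\<theta> exp (- \<theta>) P(d\<theta>)\<close>, which has mean at most \<open>2 / W\<close> because \<open>\<theta>\<^sup>2 exp (- \<theta>) \<le> 2\<close>. For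
  \<open>x > 1\<close> it is proved by bounding the exponential function below by its tangent at the point
  belonging to \<open>\<theta> = 2 / W\<close>.\<close>

lemma mixture_lower_bound:
  assumes "0 < x"
  defines "W \<equiv> mixture exp_kernel P 1"
  shows "W * exp (- (2 / W) * x) \<le> mixture exp_kernel P x"
proof (cases "x \<le> 1")
  case True
  have W: "0 < W"
    unfolding W_def by (rule mixture_pos) simp
  have "W * exp (- (2 / W) * x) \<le> W * 1"
    using W assms by (intro mult_left_mono) auto
  also have "\<dots> \<le> mixture exp_kernel P x"
    unfolding W_def using mixture_antimono[OF assms(1) True] by simp
  finally show ?thesis .
next
  case False
  have W: "0 < W"
    unfolding W_def by (rule mixture_pos) simp
  define s where "s = 2 / W"
  have sq: "\<theta>\<^sup>2 * exp (- \<theta>) \<le> 2" if "0 < \<theta>" for \<theta> :: real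
  proof -
    have "\<theta>\<^sup>2 \<le> 2 * exp \<theta>"
      using exp_lower_Taylor_quadratic[of \<theta>] that by (simp add: algebra_simps)
    then show ?thesis
      by (simp add: exp_minus field_simps)
  qed
  have "W * exp (- s * (x - 1)) =
      (\<integral>\<theta>. exp (- s * (x - 1)) * ((1 + s * (x - 1)) * exp_kernel 1 \<theta> - (x - 1) * 2) \<partial>P)"
    unfolding integral_mult_right_zero
  proof (subst Bochner_Integration.integral_diff)
    show "integrable P (\<lambda>\<theta>. (1 + s * (x - 1)) * exp_kernel 1 \<theta>)"
      by (intro integrable_mult_right integrable_exp_kernel) simp
    have "(\<integral>\<theta>. (1 + s * (x - 1)) * exp_kernel 1 \<theta> \<partial>P) = (1 + s * (x - 1)) * W"
      by (simp add: W_def mixture_def)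
    then show "W * exp (- s * (x - 1)) = exp (- s * (x - 1)) *
        ((\<integral>\<theta>. (1 + s * (x - 1)) * exp_kernel 1 \<theta> \<partial>P) - (\<integral>\<theta>. (x - 1) * 2 \<partial>P))"
      using W by (simp add: P.prob_space s_def field_simps)
  qed simp
  also have "\<dots> \<le> mixture exp_kernel P x"
    unfolding mixture_def
  proof (rule integral_mono)
    fix \<theta> assume "\<theta> \<in> space P"
    then have \<theta>: "0 < \<theta>"
      by (simp add: space_prob_measures[OF P])
    have "(1 + s * (x - 1)) * exp_kernel 1 \<theta> - (x - 1) * 2
        \<le> (1 + s * (x - 1)) * exp_kernel 1 \<theta> - (x - 1) * (\<theta>\<^sup>2 * exp (- \<theta>))"
      using mult_left_mono[OF sq[OF \<theta>], of "x - 1"] False by linarith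
    also have "\<dots> = (1 + (s * (x - 1) - \<theta> * (x - 1))) * exp_kernel 1 \<theta>"
      by (simp add: exp_kernel_def power2_eq_square algebra_simps)
    also have "\<dots> \<le> exp (s * (x - 1) - \<theta> * (x - 1)) * exp_kernel 1 \<theta>"
      using exp_kernel_pos[OF \<theta>, of 1] exp_ge_add_one_self by (intro mult_right_mono) auto
    finally have "exp (- s * (x - 1)) * ((1 + s * (x - 1)) * exp_kernel 1 \<theta> - (x - 1) * 2)
        \<le> exp (- s * (x - 1)) * (exp (s * (x - 1) - \<theta> * (x - 1)) * exp_kernel 1 \<theta>)"
      by simp
    also have "\<dots> = exp_kernel x \<theta>"
      by (simp add: exp_kernel_def flip: exp_add) (simp add: algebra_simps)
    finally show "exp (- s * (x - 1)) * ((1 + s * (x - 1)) * exp_kernel 1 \<theta> - (x - 1) * 2)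
        \<le> exp_kernel x \<theta>" .
  qed (use assms in \<open>auto intro!: integrable_exp_kernel integrable_diff integrable_mult_right\<close>)
  finally have "W * exp (- s * (x - 1)) \<le> mixture exp_kernel P x" .
  moreover have "W * exp (- s * x) \<le> W * exp (- s * (x - 1))"
    using W by (intro mult_left_mono) (auto simp: s_def field_simps)
  ultimately show ?thesis
    by (simp add: s_def)
qed

lemma mixture_density: "mixture exp_kernel P \<in> densities Rpos"
proof -
  let ?L = "restrict_space lborel Rpos"
  interpret L: sigma_finite_measure ?L
    by (rule sigma_finite_measure_restrict_space) (auto simp: lborel.sigma_finite_measure_axioms)
  interpret pair_sigma_finite P ?L ..
  have m1: "(\<lambda>p. fst p) \<in> borel_measurable (P \<Otimes>\<^sub>M ?L)"
    by (rule measurable_compose[OF measurable_fst])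
      (simp add: measurable_prob_measures[OF P] measurable_restrict_space1)
  have m2: "(\<lambda>p. snd p) \<in> borel_measurable (P \<Otimes>\<^sub>M ?L)"
    by (rule measurable_compose[OF measurable_snd measurable_restrict_space1]) simp
  have meas: "(\<lambda>(\<theta>, x). ennreal (exp_kernel x \<theta>)) \<in> borel_measurable (P \<Otimes>\<^sub>M ?L)"
    unfolding exp_kernel_def case_prod_beta
    by (intro measurable_compose[OF _ measurable_ennreal] borel_measurable_times
        measurable_compose[OF _ borel_measurable_exp] borel_measurable_uminus m1 m2)
  have one: "(\<integral>\<^sup>+x. ennreal (exp_kernel x \<theta>) \<partial>?L) = 1" if "0 < \<theta>" for \<theta>
  proof -
    have ae: "AE x in lborel. indicator Rpos x = (indicator {0..} x :: ennreal)"
      using AE_lborel_singleton[of 0] by eventually_elim (simp split: split_indicator)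
    have lim: "((\<lambda>x. - exp (- \<theta> * x)) \<longlongrightarrow> 0) at_top"
      using tendsto_minus[OF filterlim_compose[OF exp_at_bot
            filterlim_tendsto_neg_mult_at_bot[OF tendsto_const[of "- \<theta>"] _ filterlim_ident]]] that
      by simp
    have "(\<integral>\<^sup>+x. ennreal (exp_kernel x \<theta>) \<partial>?L)
        = (\<integral>\<^sup>+x. ennreal (exp_kernel x \<theta>) * indicator Rpos x \<partial>lborel)"
      by (rule nn_integral_restrict_space) simp
    also have "\<dots> = (\<integral>\<^sup>+x. ennreal (exp_kernel x \<theta>) * indicator {0..} x \<partial>lborel)"
      by (rule nn_integral_cong_AE) (use ae in eventually_elim, simp)
    also have "\<dots> = ennreal (0 - (- exp (- \<theta> * 0)))"
    proof (rule nn_integral_FTC_atLeast[OF _ _ _ lim])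
      show "(\<lambda>x. exp_kernel x \<theta>) \<in> borel_measurable borel"
        unfolding exp_kernel_def by measurable
      show "((\<lambda>x. - exp (- \<theta> * x)) has_real_derivative exp_kernel x \<theta>) (at x)" for x
        by (auto intro!: derivative_eq_intros simp: exp_kernel_def)
      show "0 \<le> exp_kernel x \<theta>" for x
        using exp_kernel_pos[OF that, of x] by simp
    qed
    finally show ?thesis by simp
  qed
  have "(\<integral>\<^sup>+x. ennreal (mixture exp_kernel P x) \<partial>?L)
      = (\<integral>\<^sup>+x. (\<integral>\<^sup>+\<theta>. ennreal (exp_kernel x \<theta>) \<partial>P) \<partial>?L)"
    by (intro nn_integral_cong ennreal_mixture) (simp add: space_restrict_space)
  also have "\<dots> = (\<integral>\<^sup>+\<theta>. (\<integral>\<^sup>+x. ennreal (exp_kernel x \<theta>) \<partial>?L) \<partial>P)"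
    by (rule Fubini'[OF meas])
  also have "\<dots> = (\<integral>\<^sup>+\<theta>. 1 \<partial>P)"
    by (intro nn_integral_cong one) (simp add: space_prob_measures[OF P])
  also have "\<dots> = 1"
    by (simp add: P.emeasure_space_1)
  finally have "(\<integral>\<^sup>+x. ennreal (mixture exp_kernel P x) \<partial>?L) = 1" .
  moreover have "mixture exp_kernel P \<in> borel_measurable ?L"
    using borel_measurable_continuous_on_restrict[OF continuous_on_mixture]
    by (simp add: measurable_restrict_lborel)
  ultimately show ?thesis
    using mixture_pos by (auto simp: densities_def less_imp_le)
qed

end

section \<open>Completely monotone functions are nearly exponential mixtures\<close>

text \<open>The sign is the one for which complete monotonicity means nonnegativity for every \<open>k\<close>; then
  each of these functions is decreasing and minus its derivative is the next one.\<close>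

definition alt_deriv :: "(real \<Rightarrow> real) \<Rightarrow> nat \<Rightarrow> real \<Rightarrow> real" where
  "alt_deriv \<phi> k x = (- 1) ^ k * (deriv ^^ k) \<phi> x"

text \<open>Cauchy's formula for repeated integration towards infinity: by Tonelli's theorem, integrating
  against \<open>(s - t)\<^sup>n / n!\<close> and then over \<open>t\<close> raises the exponent by one. Working with
  \<open>ennreal\<close> values avoids all questions of integrability.\<close>

lemma nn_integral_iterate_power:
  fixes g :: "real \<Rightarrow> ennreal"
  assumes [measurable]: "g \<in> borel_measurable borel"
  shows "(\<integral>\<^sup>+t. (\<integral>\<^sup>+s. g s * ennreal ((s - t) ^ n / fact n) * indicator {t..} s \<partial>lborel)
        * indicator {x..} t \<partial>lborel)
    = (\<integral>\<^sup>+s. g s * ennreal ((s - x) ^ Suc n / fact (Suc n)) * indicator {x..} s \<partial>lborel)"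
proof -
  let ?p = "\<lambda>t s. if x \<le> t \<and> t \<le> s then ennreal ((s - t) ^ n / fact n) else 0"
  have inner: "(\<integral>\<^sup>+t. ?p t s \<partial>lborel)
      = ennreal ((s - x) ^ Suc n / fact (Suc n)) * indicator {x..} s" for s
  proof (cases "x \<le> s")
    case True
    have "(\<integral>\<^sup>+t. ?p t s \<partial>lborel)
        = (\<integral>\<^sup>+t. ennreal ((s - t) ^ n / fact n) * indicator {x..s} t \<partial>lborel)"
      by (intro nn_integral_cong) (simp split: split_indicator)
    also have "\<dots> = ennreal (- ((s - s) ^ Suc n / fact (Suc n)) - (- ((s - x) ^ Suc n / fact (Suc n))))"
    proof (rule nn_integral_FTC_Icc[OF _ _ _ True])
      have cancel: "- (c * a * (0 - 1) / (c * b)) = a / b" if "c \<noteq> 0" for a b c :: real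
        using that by simp
      fix t :: real
      have "((\<lambda>t. - ((s - t) ^ Suc n / fact (Suc n))) has_real_derivative
          - (real (Suc n) * (s - t) ^ n * (0 - 1) / fact (Suc n))) (at t)"
        by (intro derivative_eq_intros | simp)+
      moreover have "- (real (Suc n) * (s - t) ^ n * (0 - 1) / fact (Suc n)) = (s - t) ^ n / fact n"
        unfolding fact_Suc by (rule cancel) simp
      ultimately show "((\<lambda>t. - ((s - t) ^ Suc n / fact (Suc n))) has_real_derivative
          (s - t) ^ n / fact n) (at t)"
        by simp
    qed auto
    finally show ?thesis
      using True by simp
  next
    case False
    then have "?p t s = 0" for t by auto
    then show ?thesis
      using False by simp
  qed
  have "(\<integral>\<^sup>+t. (\<integral>\<^sup>+s. g s * ennreal ((s - t) ^ n / fact n) * indicator {t..} s \<partial>lborel)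
        * indicator {x..} t \<partial>lborel) = (\<integral>\<^sup>+t. (\<integral>\<^sup>+s. g s * ?p t s \<partial>lborel) \<partial>lborel)"
    by (intro nn_integral_cong) (auto intro!: nn_integral_cong split: split_indicator)
  also have "\<dots> = (\<integral>\<^sup>+s. (\<integral>\<^sup>+t. g s * ?p t s \<partial>lborel) \<partial>lborel)"
    by (rule lborel_pair.Fubini') measurable
  also have "\<dots> = (\<integral>\<^sup>+s. g s * (\<integral>\<^sup>+t. ?p t s \<partial>lborel) \<partial>lborel)"
    by (intro nn_integral_cong nn_integral_cmult) measurable
  finally show ?thesis
    by (simp add: inner mult.assoc)
qed

context
  fixes \<phi> :: "real \<Rightarrow> real"
  assumes cm: "completely_monotone \<phi>"
begin

lemma alt_deriv_nonneg: "0 < x \<Longrightarrow> 0 \<le> alt_deriv \<phi> k x"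
  using cm by (simp add: completely_monotone_def alt_deriv_def)

lemma DERIV_alt_deriv:
  assumes "0 < x"
  shows "(alt_deriv \<phi> k has_real_derivative - alt_deriv \<phi> (Suc k) x) (at x)"
proof -
  have "((deriv ^^ k) \<phi> has_real_derivative (deriv ^^ Suc k) \<phi> x) (at x)"
    using cm assms by (simp add: completely_monotone_def field_differentiable_derivI)
  from DERIV_cmult[OF this, of "(- 1) ^ k"] show ?thesis
    unfolding alt_deriv_def [abs_def] by simp
qed

lemma continuous_on_alt_deriv: "continuous_on Rpos (alt_deriv \<phi> k)"
  using DERIV_alt_deriv by (intro continuous_at_imp_continuous_on) (auto intro: DERIV_isCont)

lemma alt_deriv_indicator_measurable [measurable]:
  "(\<lambda>t. indicator Rpos t * alt_deriv \<phi> k t) \<in> borel_measurable borel"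
  using borel_measurable_continuous_on_indicator[OF _ continuous_on_alt_deriv, of k] by simp

lemma alt_deriv_antimono:
  assumes "0 < x" "x \<le> y"
  shows "alt_deriv \<phi> k y \<le> alt_deriv \<phi> k x"
  using assms(2)
proof (rule DERIV_nonpos_imp_nonincreasing)
  fix z assume "x \<le> z"
  then show "\<exists>d. (alt_deriv \<phi> k has_real_derivative d) (at z) \<and> d \<le> 0"
    using DERIV_alt_deriv[of z k] alt_deriv_nonneg[of z "Suc k"] assms(1) by auto
qed

text \<open>A nonnegative decreasing function whose antiderivative is bounded must vanish at infinity.\<close>

lemma alt_deriv_Suc_tendsto_0: "(alt_deriv \<phi> (Suc k) \<longlongrightarrow> 0) at_top"
proof (rule tendsto_sandwich)
  show "\<forall>\<^sub>F y in at_top. 0 \<le> alt_deriv \<phi> (Suc k) y"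
    using eventually_gt_at_top[of 0] by eventually_elim (rule alt_deriv_nonneg)
  show "\<forall>\<^sub>F y in at_top. alt_deriv \<phi> (Suc k) y \<le> alt_deriv \<phi> k 1 / (y - 1)"
    using eventually_gt_at_top[of 1]
  proof eventually_elim
    case (elim y)
    then obtain z where z: "1 < z" "z < y"
      and eq: "alt_deriv \<phi> k y - alt_deriv \<phi> k 1 = (y - 1) * - alt_deriv \<phi> (Suc k) z"
      using MVT2[of 1 y "alt_deriv \<phi> k" "\<lambda>z. - alt_deriv \<phi> (Suc k) z"] DERIV_alt_deriv by force
    have "(y - 1) * alt_deriv \<phi> (Suc k) y \<le> (y - 1) * alt_deriv \<phi> (Suc k) z"
      using alt_deriv_antimono[of z y "Suc k"] z by (intro mult_left_mono) auto
    also have "\<dots> \<le> alt_deriv \<phi> k 1"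
      using eq alt_deriv_nonneg[of y k] elim by simp
    finally show ?case
      using elim by (simp add: field_simps)
  qed
  have "filterlim (\<lambda>y::real. - 1 + y) at_top at_top"
    by (rule filterlim_tendsto_add_at_top[OF tendsto_const filterlim_ident])
  then have "filterlim (\<lambda>y::real. y - 1) at_top at_top"
    by simp
  then show "((\<lambda>y. alt_deriv \<phi> k 1 / (y - 1)) \<longlongrightarrow> 0) at_top"
    by (rule real_tendsto_divide_at_top[OF tendsto_const])
qed simp

lemma nn_integral_alt_deriv:
  assumes "0 < x"
  shows "(\<integral>\<^sup>+t. ennreal (indicator Rpos t * alt_deriv \<phi> (Suc (Suc k)) t) * indicator {x..} t \<partial>lborel)
    = ennreal (alt_deriv \<phi> (Suc k) x)"
proof -
  have "(\<integral>\<^sup>+t. ennreal (indicator Rpos t * alt_deriv \<phi> (Suc (Suc k)) t) * indicator {x..} t \<partial>lborel)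
    = ennreal (0 - - alt_deriv \<phi> (Suc k) x)"
  proof (rule nn_integral_FTC_atLeast)
    show "((\<lambda>t. - alt_deriv \<phi> (Suc k) t) \<longlongrightarrow> 0) at_top"
      using tendsto_minus[OF alt_deriv_Suc_tendsto_0] by simp
    fix t assume "x \<le> t"
    with assms have t: "0 < t" by simp
    then show "0 \<le> indicator Rpos t * alt_deriv \<phi> (Suc (Suc k)) t"
      by (simp add: alt_deriv_nonneg)
    show "((\<lambda>t. - alt_deriv \<phi> (Suc k) t) has_real_derivative
        indicator Rpos t * alt_deriv \<phi> (Suc (Suc k)) t) (at t)"
      using DERIV_minus[OF DERIV_alt_deriv[OF t, of "Suc k"]] t by simp
  qed simp
  then show ?thesis by simp
qed

text \<open>Taylor's formula with integral remainder, expanded at infinity, where all the boundary terms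
  vanish.\<close>

lemma alt_deriv_Taylor:
  assumes "0 < x"
  shows "ennreal (alt_deriv \<phi> (Suc k) x) =
    (\<integral>\<^sup>+s. ennreal (indicator Rpos s * alt_deriv \<phi> (Suc (Suc (k + n))) s)
      * ennreal ((s - x) ^ n / fact n) * indicator {x..} s \<partial>lborel)"
  using assms
proof (induction n arbitrary: k x)
  case 0
  then show ?case
    by (simp add: nn_integral_alt_deriv)
next
  case (Suc n)
  have "ennreal (alt_deriv \<phi> (Suc k) x) =
      (\<integral>\<^sup>+t. ennreal (indicator Rpos t * alt_deriv \<phi> (Suc (Suc k)) t) * indicator {x..} t \<partial>lborel)"
    using Suc.prems by (simp add: nn_integral_alt_deriv)
  also have "\<dots> = (\<integral>\<^sup>+t. (\<integral>\<^sup>+s. ennreal (indicator Rpos s * alt_deriv \<phi> (Suc (Suc (Suc k + n))) s)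
      * ennreal ((s - t) ^ n / fact n) * indicator {t..} s \<partial>lborel) * indicator {x..} t \<partial>lborel)"
  proof (rule nn_integral_cong)
    fix t :: real
    show "ennreal (indicator Rpos t * alt_deriv \<phi> (Suc (Suc k)) t) * indicator {x..} t =
      (\<integral>\<^sup>+s. ennreal (indicator Rpos s * alt_deriv \<phi> (Suc (Suc (Suc k + n))) s)
      * ennreal ((s - t) ^ n / fact n) * indicator {t..} s \<partial>lborel) * indicator {x..} t"
      using Suc.IH[of t "Suc k"] Suc.prems by (cases "x \<le> t") simp_all
  qed
  also have "\<dots> = (\<integral>\<^sup>+s. ennreal (indicator Rpos s * alt_deriv \<phi> (Suc (Suc (Suc k + n))) s)
      * ennreal ((s - x) ^ Suc n / fact (Suc n)) * indicator {x..} s \<partial>lborel)"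
    by (rule nn_integral_iterate_power) simp
  finally show ?case
    by simp
qed

text \<open>Integrating Taylor's formula over \<open>x > 0\<close> raises the exponent once more. For \<open>k = 0\<close> the left
  side is the mass of the density \<open>- \<phi>'\<close>, and the right side that of the mixing measure
  constructed from it.\<close>

lemma nn_integral_alt_deriv_moment:
  "(\<integral>\<^sup>+x. ennreal (alt_deriv \<phi> (Suc k) x) \<partial>restrict_space lborel Rpos) =
    (\<integral>\<^sup>+s. ennreal (alt_deriv \<phi> (Suc (Suc (k + n))) s * (s ^ Suc n / fact (Suc n)))
      \<partial>restrict_space lborel Rpos)"
proof -
  have ae: "AE x in lborel. indicator Rpos x = (indicator {0..} x :: ennreal) \<and> x \<noteq> (0::real)"
    using AE_lborel_singleton[of 0] by eventually_elim (simp split: split_indicator)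
  have "(\<integral>\<^sup>+x. ennreal (alt_deriv \<phi> (Suc k) x) \<partial>restrict_space lborel Rpos) =
      (\<integral>\<^sup>+x. ennreal (alt_deriv \<phi> (Suc k) x) * indicator Rpos x \<partial>lborel)"
    by (rule nn_integral_restrict_space) simp
  also have "\<dots> = (\<integral>\<^sup>+t. (\<integral>\<^sup>+s. ennreal (indicator Rpos s * alt_deriv \<phi> (Suc (Suc (k + n))) s)
      * ennreal ((s - t) ^ n / fact n) * indicator {t..} s \<partial>lborel) * indicator {0..} t \<partial>lborel)"
    by (rule nn_integral_cong_AE)
      (use ae in eventually_elim, auto simp: alt_deriv_Taylor[of _ k n] split: split_indicator)
  also have "\<dots> = (\<integral>\<^sup>+s. ennreal (indicator Rpos s * alt_deriv \<phi> (Suc (Suc (k + n))) s)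
      * ennreal ((s - 0) ^ Suc n / fact (Suc n)) * indicator {0..} s \<partial>lborel)"
    by (rule nn_integral_iterate_power) simp
  also have "\<dots> = (\<integral>\<^sup>+s. ennreal (alt_deriv \<phi> (Suc (Suc (k + n))) s * (s ^ Suc n / fact (Suc n)))
      * indicator Rpos s \<partial>lborel)"
    by (intro nn_integral_cong)
      (auto simp: alt_deriv_nonneg simp flip: ennreal_mult simp del: power_Suc fact_Suc split: split_indicator)
  also have "\<dots> = (\<integral>\<^sup>+s. ennreal (alt_deriv \<phi> (Suc (Suc (k + n))) s * (s ^ Suc n / fact (Suc n)))
      \<partial>restrict_space lborel Rpos)"
    by (rule nn_integral_restrict_space[symmetric]) simp
  finally show ?thesis .
qed

text \<open>Taylor's formula writes \<open>- \<phi>'\<close> as a superposition of the functions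
  \<open>x \<mapsto> (s - x)\<^sup>n / n!\<close> for \<open>s \<ge> x\<close>. Since \<open>(1 - x / s)\<^sup>n \<le> exp (- n x / s)\<close>, each of them is at most a multiple
  of an exponential density with rate \<open>\<theta> = n / s\<close>, and the multiples have total mass
  \<open>(n + 1) / n\<close>. So the mixing measure is the law of \<open>n / s\<close> when \<open>s\<close> has density \<open>w\<close> below. Letting
  \<open>n\<close> tend to infinity and extracting a weak limit would give Bernstein's theorem; the inequality
  for a single \<open>n\<close> is what the divergence estimate needs.\<close>

lemma exists_mixture_dominating:
  fixes n :: nat
  assumes mass: "(\<integral>\<^sup>+x. ennreal (alt_deriv \<phi> 1 x) \<partial>restrict_space lborel Rpos) = 1" and n: "0 < n"
  obtains P where "P \<in> prob_measures Rpos"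
    and "\<And>x. 0 < x \<Longrightarrow> alt_deriv \<phi> 1 x \<le> (1 + 1 / n) * mixture exp_kernel P x"
proof -
  let ?L = "restrict_space lborel Rpos"
  define w where "w t = alt_deriv \<phi> (Suc (Suc n)) t * (t ^ Suc n / fact (Suc n))" for t
  define T where "T t = real n / t" for t
  define P where "P = distr (density ?L (\<lambda>t. ennreal (w t))) (restrict_space borel Rpos) T"
  have bL: "f \<in> borel_measurable ?L" if "continuous_on Rpos f" for f :: "real \<Rightarrow> real"
    using borel_measurable_continuous_on_restrict[OF that]
    by (simp add: measurable_restrict_lborel)
  have w_meas: "w \<in> borel_measurable ?L"
    unfolding w_def by (intro bL continuous_intros continuous_on_alt_deriv) auto
  have T_meas: "T \<in> measurable (density ?L (\<lambda>t. ennreal (w t))) (restrict_space borel Rpos)"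
  proof (rule measurable_restrict_space2)
    show "T \<in> space (density ?L (\<lambda>t. ennreal (w t))) \<rightarrow> Rpos"
      using n by (auto simp: T_def space_restrict_space)
    have "T \<in> borel_measurable ?L"
      unfolding T_def by (intro bL continuous_intros) auto
    then show "T \<in> borel_measurable (density ?L (\<lambda>t. ennreal (w t)))"
      by simp
  qed
  have "emeasure (density ?L (\<lambda>t. ennreal (w t))) (space ?L) = (\<integral>\<^sup>+t. ennreal (w t) \<partial>?L)"
    using measurable_compose[OF w_meas measurable_ennreal]
    by (subst emeasure_density) (auto intro!: nn_integral_cong sets.top[of ?L, simplified])
  also have "\<dots> = 1"
    using mass nn_integral_alt_deriv_moment[of 0 n] by (simp add: w_def)
  finally have "prob_space (density ?L (\<lambda>t. ennreal (w t)))"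
    by (intro prob_spaceI) simp
  then have "prob_space P"
    unfolding P_def by (rule prob_space.prob_space_distr[OF _ T_meas])
  then have P: "P \<in> prob_measures Rpos"
    by (simp add: prob_measures_iff P_def)
  have "alt_deriv \<phi> 1 x \<le> (1 + 1 / n) * mixture exp_kernel P x" if x: "0 < x" for x
  proof -
    have "ennreal (alt_deriv \<phi> 1 x) = (\<integral>\<^sup>+s. ennreal (indicator Rpos s * alt_deriv \<phi> (Suc (Suc n)) s)
        * ennreal ((s - x) ^ n / fact n) * indicator {x..} s \<partial>lborel)"
      using alt_deriv_Taylor[OF x, of 0 n] by simp
    also have "\<dots> \<le> (\<integral>\<^sup>+s. ennreal ((1 + 1 / n) * (w s * exp_kernel x (T s))) * indicator Rpos s \<partial>lborel)"
    proof (rule nn_integral_mono)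
      fix s :: real
      show "ennreal (indicator Rpos s * alt_deriv \<phi> (Suc (Suc n)) s)
          * ennreal ((s - x) ^ n / fact n) * indicator {x..} s
        \<le> ennreal ((1 + 1 / n) * (w s * exp_kernel x (T s))) * indicator Rpos s"
      proof (cases "x \<le> s")
        case True
        with x have s: "0 < s" by simp
        have "(s - x) ^ n = s ^ n * (1 - x / s) ^ n"
          using s by (simp add: field_simps flip: power_mult_distrib)
        also have "\<dots> \<le> s ^ n * exp (- (x / s)) ^ n"
          using s True exp_ge_add_one_self[of "- (x / s)"]
          by (intro mult_left_mono power_mono) auto
        also have "exp (- (x / s)) ^ n = exp (- T s * x)"
          by (simp add: T_def flip: exp_of_nat_mult)
        finally have "(s - x) ^ n / fact n \<le> s ^ n * exp (- T s * x) / fact n"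
          by (rule divide_right_mono) simp
        \<comment> \<open>The factor \<open>1 + 1 / n\<close> is the price for a density \<open>w\<close> of total mass one: it is left over
          when \<open>n / s\<close> is split off as the \<open>\<theta>\<close> in front of the exponential density.\<close>
        also have "\<dots> = (1 + 1 / n) * (s ^ Suc n / fact (Suc n) * exp_kernel x (T s))"
        proof -
          have c: "1 + 1 / real n = real (Suc n) / real n"
            using n by (simp add: field_simps)
          have cancel: "a * e / f = c / d * (s * a / (c * f) * (d / s * e))"
            if "c \<noteq> 0" "d \<noteq> 0" for a c d e f :: real
            using that s by simp
          show ?thesis
            unfolding exp_kernel_def T_def power_Suc fact_Suc c by (rule cancel) (use n in auto)
        qed
        finally have "alt_deriv \<phi> (Suc (Suc n)) s * ((s - x) ^ n / fact n)
          \<le> alt_deriv \<phi> (Suc (Suc n)) s * ((1 + 1 / n) * (s ^ Suc n / fact (Suc n) * exp_kernel x (T s)))"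
          using alt_deriv_nonneg[OF s] by (intro mult_left_mono) auto
        also have "\<dots> = (1 + 1 / n) * (w s * exp_kernel x (T s))"
          by (simp add: w_def)
        finally have "ennreal (alt_deriv \<phi> (Suc (Suc n)) s * ((s - x) ^ n / fact n))
            \<le> ennreal ((1 + 1 / n) * (w s * exp_kernel x (T s)))"
          by (rule ennreal_leI)
        then show ?thesis
          using s True alt_deriv_nonneg[OF s] by (simp flip: ennreal_mult)
      qed simp
    qed
    also have "\<dots> = (\<integral>\<^sup>+s. ennreal (1 + 1 / n) * (ennreal (w s) * ennreal (exp_kernel x (T s))) \<partial>?L)"
    proof (subst nn_integral_restrict_space[symmetric], simp, rule nn_integral_cong)
      fix s assume "s \<in> space ?L"
      then have s: "0 < s"
        by (simp add: space_restrict_space)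
      have "0 \<le> w s" "0 \<le> exp_kernel x (T s)"
        using s alt_deriv_nonneg[OF s] n by (auto simp: w_def exp_kernel_def T_def)
      then show "ennreal ((1 + 1 / n) * (w s * exp_kernel x (T s)))
          = ennreal (1 + 1 / n) * (ennreal (w s) * ennreal (exp_kernel x (T s)))"
        by (simp add: ennreal_mult)
    qed
    also have "\<dots> = ennreal (1 + 1 / n) * (\<integral>\<^sup>+s. ennreal (w s) * ennreal (exp_kernel x (T s)) \<partial>?L)"
    proof (rule nn_integral_cmult)
      have "(\<lambda>s. w s * exp_kernel x (T s)) \<in> borel_measurable ?L"
        unfolding w_def T_def exp_kernel_def
        by (intro bL continuous_intros continuous_on_alt_deriv) auto
      have "(\<lambda>s. exp_kernel x (T s)) \<in> borel_measurable ?L"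
        unfolding T_def exp_kernel_def by (intro bL continuous_intros) auto
      with w_meas show "(\<lambda>s. ennreal (w s) * ennreal (exp_kernel x (T s))) \<in> borel_measurable ?L"
        by (intro borel_measurable_times_ennreal measurable_compose[OF _ measurable_ennreal])
    qed
    also have "(\<integral>\<^sup>+s. ennreal (w s) * ennreal (exp_kernel x (T s)) \<partial>?L)
        = (\<integral>\<^sup>+s. ennreal (exp_kernel x (T s)) \<partial>density ?L (\<lambda>t. ennreal (w t)))"
    proof (rule nn_integral_density[symmetric])
      have "(\<lambda>s. exp_kernel x (T s)) \<in> borel_measurable ?L"
        unfolding T_def exp_kernel_def by (intro bL continuous_intros) auto
      then show "(\<lambda>s. ennreal (exp_kernel x (T s))) \<in> borel_measurable ?L"
        by (rule measurable_compose[OF _ measurable_ennreal])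
      show "(\<lambda>s. ennreal (w s)) \<in> borel_measurable ?L"
        using w_meas by (rule measurable_compose[OF _ measurable_ennreal])
    qed
    also have "\<dots> = (\<integral>\<^sup>+\<theta>. ennreal (exp_kernel x \<theta>) \<partial>P)"
      unfolding P_def using T_meas
      by (intro nn_integral_distr[symmetric])
        (auto intro!: measurable_restrict_space1 measurable_compose[OF measurable_exp_kernel])
    also have "\<dots> = ennreal (mixture exp_kernel P x)"
      by (rule ennreal_mixture[OF P x, symmetric])
    also have "ennreal (1 + 1 / n) * ennreal (mixture exp_kernel P x)
        = ennreal ((1 + 1 / n) * mixture exp_kernel P x)"
      using mixture_pos[OF P x] by (intro ennreal_mult[symmetric]) auto
    finally show ?thesis
      using mixture_pos[OF P x] by (subst (asm) ennreal_le_iff) auto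
  qed
  with P show thesis ..
qed

end

lemma density_integrable_lborel:
  assumes "f \<in> densities Rpos"
  shows "integrable (restrict_space lborel Rpos) f"
proof (rule integrableI_nonneg)
  show "AE x in restrict_space lborel Rpos. 0 \<le> f x"
    using assms by (intro AE_I2) (simp add: densities_def space_restrict_space)
qed (use assms in \<open>simp_all add: densities_def\<close>)

text \<open>Continuity of \<open>f0\<close> gives this at every point rather than almost everywhere. It need not
  extend to \<open>0\<close>, so the fundamental theorem is applied from a point \<open>a\<close> between \<open>0\<close> and \<open>x\<close>.\<close>

lemma alt_deriv_survival_function:
  assumes f0: "f0 \<in> densities Rpos" and cont: "continuous_on Rpos f0" and x: "0 < x"
  shows "alt_deriv (\<lambda>x. 1 - distribution_function f0 x) 1 x = f0 x"
proof -
  define a where "a = x / 2"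
  have a: "0 < a" "a < x"
    using x by (auto simp: a_def)
  have int: "set_integrable lborel Rpos f0"
    using density_integrable_lborel[OF f0]
    by (simp add: set_integrable_def integrable_restrict_space)
  define C where "C = (LINT t:{0<..<a}|lborel. f0 t)"
  have F: "distribution_function f0 u = C + integral {a..u} f0" if "a < u" for u
  proof -
    have int_a: "set_integrable lborel {0<..<a} f0"
      by (rule set_integrable_subset[OF int]) auto
    have int_u: "set_integrable lborel {a..u} f0"
      by (rule set_integrable_subset[OF int]) (use a in auto)
    have "{0<..u} = {0<..<a} \<union> {a..u}"
      using a that by auto
    then have "distribution_function f0 u = (LINT t:({0<..<a} \<union> {a..u})|lborel. f0 t)"
      by (simp add: distribution_function_def)
    also have "\<dots> = C + (LINT t:{a..u}|lborel. f0 t)"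
      unfolding C_def by (rule set_integral_Un[OF _ int_a int_u]) auto
    also have "(LINT t:{a..u}|lborel. f0 t) = integral {a..u} f0"
      by (rule set_borel_integral_eq_integral(2)[OF int_u])
    finally show ?thesis .
  qed
  have "((\<lambda>u. integral {a..u} f0) has_real_derivative f0 x) (at x within {a..2 * x})"
    using a x by (intro integral_has_real_derivative continuous_on_subset[OF cont]) auto
  moreover have "at x within {a..2 * x} = at x"
    using a x by (intro at_within_Icc_at) auto
  ultimately have "((\<lambda>u. integral {a..u} f0) has_real_derivative f0 x) (at x)"
    by simp
  then have "((\<lambda>u. 1 - (C + integral {a..u} f0)) has_real_derivative 0 - (0 + f0 x)) (at x)"
    by (intro DERIV_diff DERIV_add DERIV_const)
  then have "((\<lambda>u. 1 - distribution_function f0 u) has_real_derivative 0 - (0 + f0 x)) (at x)"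
    by (rule has_field_derivative_transform_within_open[of _ _ _ "{a<..}"]) (use a F in auto)
  then show ?thesis
    by (simp add: alt_deriv_def DERIV_imp_deriv)
qed

section \<open>Weak neighbourhoods and measurability\<close>

lemma openin_mixture_gt:
  assumes "0 < y"
  shows "openin (weak_topology Rpos) {P \<in> prob_measures Rpos. c < mixture exp_kernel P y}"
proof -
  have "continuous_on Rpos (exp_kernel y)"
    unfolding exp_kernel_def by (intro continuous_intros)
  moreover have "bounded (exp_kernel y ` Rpos)"
    using exp_kernel_le[OF _ assms] exp_kernel_pos[THEN less_imp_le]
    by (intro boundedI[where B = "1 / y"]) auto
  ultimately have "openin (weak_topology Rpos)
      {P \<in> prob_measures Rpos. (LINT \<theta>|P. exp_kernel y \<theta>) \<in> {c<..}}"
    unfolding weak_topology_def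
    by (intro topology_generated_by_Basis CollectI exI[of _ "exp_kernel y"] exI[of _ "{c<..}"]) simp
  then show ?thesis
    by (simp add: mixture_def)
qed

lemma openin_weak_topology_subset:
  assumes "openin (weak_topology S) U"
  shows "U \<subseteq> prob_measures S"
proof -
  have "topspace (weak_topology S) \<subseteq> prob_measures S"
    unfolding weak_topology_def by auto
  then show ?thesis
    using openin_subset[OF assms] by blast
qed

lemma space_prior: "prior_on S \<pi> \<Longrightarrow> space \<pi> = prob_measures S"
  using sets_eq_imp_space_eq[of \<pi> "weak_borel S"] openin_weak_topology_subset
  by (auto simp: prior_on_def weak_borel_def space_measure_of_conv)

lemma openin_weak_topology_sets:
  assumes "prior_on S \<pi>" "openin (weak_topology S) U"
  shows "U \<in> sets \<pi>"
proof -
  have "{U. openin (weak_topology S) U} \<subseteq> Pow (prob_measures S)"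
    using openin_weak_topology_subset by auto
  then have "sets (weak_borel S) = sigma_sets (prob_measures S) {U. openin (weak_topology S) U}"
    unfolding weak_borel_def by (rule sets_measure_of)
  then show ?thesis
    using assms by (auto simp: prior_on_def intro: sigma_sets.Basic)
qed

lemma borel_measurable_mixture_at:
  assumes "prior_on Rpos \<pi>" "0 < y"
  shows "(\<lambda>P. mixture exp_kernel P y) \<in> borel_measurable \<pi>"
  unfolding borel_measurable_iff_greater
  using openin_weak_topology_sets[OF assms(1) openin_mixture_gt[OF assms(2)]]
  by (simp add: space_prior[OF assms(1)])

text \<open>Evaluation at a fixed point is measurable in \<open>P\<close>; evaluation at a point rounded to a
  multiple of \<open>1 / (n + 1)\<close> is a countable case distinction over such maps; and continuity of the
  mixtures lets \<open>n\<close> tend to infinity.\<close>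

lemma borel_measurable_mixture_pair:
  assumes \<pi>: "prior_on Rpos \<pi>"
  shows "(\<lambda>(P, x). mixture exp_kernel P x) \<in> borel_measurable (\<pi> \<Otimes>\<^sub>M restrict_space lborel Rpos)"
    (is "_ \<in> borel_measurable ?M")
proof -
  define y :: "nat \<Rightarrow> nat \<Rightarrow> real" where "y n i = real (Suc i) / real (Suc n)" for n i
  define r :: "nat \<Rightarrow> real \<Rightarrow> nat" where "r n x = nat \<lfloor>real (Suc n) * x\<rfloor>" for n x
  show ?thesis
  proof (rule borel_measurable_LIMSEQ_real)
    fix n
    have "(\<lambda>p. mixture exp_kernel (fst p) (y n i)) \<in> borel_measurable ?M" for i
      by (rule measurable_compose[OF measurable_fst borel_measurable_mixture_at[OF \<pi>]])
        (simp add: y_def)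
    moreover have "(\<lambda>p. r n (snd p)) \<in> measurable ?M (count_space UNIV)"
    proof (rule measurable_compose[OF measurable_snd])
      have "r n \<in> measurable borel (count_space UNIV)"
        unfolding r_def by measurable
      then show "r n \<in> measurable (restrict_space lborel Rpos) (count_space UNIV)"
        by (intro measurable_restrict_space1) simp
    qed
    ultimately show "(\<lambda>p. mixture exp_kernel (fst p) (y n (r n (snd p)))) \<in> borel_measurable ?M"
      by (rule measurable_compose_countable)
  next
    fix p assume p: "p \<in> space ?M"
    obtain P x where p_eq: "p = (P, x)" by (cases p)
    from p have P: "P \<in> prob_measures Rpos" and x: "0 < x"
      by (auto simp: p_eq space_pair_measure space_prior[OF \<pi>] space_restrict_space)
    have bounds: "x \<le> y n (r n x)" "y n (r n x) \<le> x + 1 / real (Suc n)" for n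
    proof -
      have r: "real (r n x) = of_int \<lfloor>real (Suc n) * x\<rfloor>"
        using x by (simp add: r_def)
      have "real (Suc n) * x \<le> real (Suc (r n x))" "real (Suc (r n x)) \<le> real (Suc n) * x + 1"
        unfolding of_nat_Suc[of "r n x"] r by linarith+
      then have "real (Suc n) * x / real (Suc n) \<le> real (Suc (r n x)) / real (Suc n)"
        "real (Suc (r n x)) / real (Suc n) \<le> (real (Suc n) * x + 1) / real (Suc n)"
        by (intro divide_right_mono; simp)+
      then show "x \<le> y n (r n x)" "y n (r n x) \<le> x + 1 / real (Suc n)"
        unfolding y_def add_divide_distrib by simp_all
    qed
    have "(\<lambda>n. x + 1 / real (Suc n)) \<longlonglongrightarrow> x + 0"
      by (rule tendsto_add[OF tendsto_const LIMSEQ_Suc[OF lim_1_over_n]])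
    then have lim: "(\<lambda>n. x + 1 / real (Suc n)) \<longlonglongrightarrow> x"
      by simp
    have "(\<lambda>n. y n (r n x)) \<longlonglongrightarrow> x"
      by (rule tendsto_sandwich[OF always_eventually always_eventually tendsto_const lim])
        (use bounds in auto)
    then have "(\<lambda>n. mixture exp_kernel P (y n (r n x))) \<longlonglongrightarrow> mixture exp_kernel P x"
    proof (rule isCont_tendsto_compose[rotated])
      show "isCont (mixture exp_kernel P) x"
        using continuous_on_mixture[OF P] x by (simp add: continuous_on_eq_continuous_at)
    qed
    then show "(\<lambda>n. mixture exp_kernel (fst p) (y n (r n (snd p)))) \<longlonglongrightarrow>
        (case p of (P, x) \<Rightarrow> mixture exp_kernel P x)"
      by (simp add: p_eq)
  qed
qed

section \<open>Kullback--Leibler divergence from a mixture\<close>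

text \<open>Mixtures are strictly positive, so the infinite value in the integrand does not occur.\<close>

lemma kl_div_mixture:
  assumes P: "P \<in> prob_measures Rpos"
  shows "kl_div Rpos f0 (mixture exp_kernel P) =
    enn2ereal (\<integral>\<^sup>+x. ennreal (f0 x * ln (f0 x / mixture exp_kernel P x)) \<partial>restrict_space lborel Rpos) -
    enn2ereal (\<integral>\<^sup>+x. ennreal (- (f0 x * ln (f0 x / mixture exp_kernel P x))) \<partial>restrict_space lborel Rpos)"
proof -
  have "kl_integrand f0 (mixture exp_kernel P) x = ereal (f0 x * ln (f0 x / mixture exp_kernel P x))"
    if "0 < x" for x
    using mixture_pos[OF P that] by (simp add: kl_integrand_def)
  then show ?thesis
    unfolding kl_div_def
    by (intro arg_cong2[where f = minus] arg_cong[where f = enn2ereal] nn_integral_cong)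
      (auto simp: space_restrict_space e2ennreal_ereal)
qed

lemma sets_kl_div_mixture_less:
  assumes \<pi>: "prior_on Rpos \<pi>" and f0: "f0 \<in> borel_measurable (restrict_space lborel Rpos)"
  shows "{P \<in> space \<pi>. kl_div Rpos f0 (mixture exp_kernel P) < ereal \<epsilon>} \<in> sets \<pi>"
proof -
  let ?L = "restrict_space lborel Rpos"
  interpret L: sigma_finite_measure ?L
    by (rule sigma_finite_measure_restrict_space) (auto simp: lborel.sigma_finite_measure_axioms)
  define k where "k P x = f0 x * ln (f0 x / mixture exp_kernel P x)" for P x
  have k: "(\<lambda>(P, x). k P x) \<in> borel_measurable (\<pi> \<Otimes>\<^sub>M ?L)"
    unfolding k_def case_prod_beta
    using measurable_compose[OF measurable_snd f0] borel_measurable_mixture_pair[OF \<pi>]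
    by (intro borel_measurable_times borel_measurable_ln borel_measurable_divide)
      (auto simp: case_prod_beta)
  have "(\<lambda>P. enn2ereal (\<integral>\<^sup>+x. ennreal (k P x) \<partial>?L) - enn2ereal (\<integral>\<^sup>+x. ennreal (- k P x) \<partial>?L))
      \<in> borel_measurable \<pi>"
    using k by (intro borel_measurable_ereal_diff measurable_compose[OF _ measurable_enn2ereal]
        L.borel_measurable_nn_integral) (auto simp: case_prod_beta)
  then have "{P \<in> space \<pi>. enn2ereal (\<integral>\<^sup>+x. ennreal (k P x) \<partial>?L)
      - enn2ereal (\<integral>\<^sup>+x. ennreal (- k P x) \<partial>?L) < ereal \<epsilon>} \<in> sets \<pi>"
    by measurable
  then show ?thesis
    by (simp add: kl_div_mixture space_prior[OF \<pi>] k_def cong: conj_cong)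
qed

text \<open>The final \<open>\<sigma>\<close>-algebra makes exactly the sets with measurable preimage measurable.\<close>

lemma emeasure_induced_prior:
  assumes \<pi>: "prior_on Rpos \<pi>" and A: "A \<subseteq> densities Rpos"
    and sets: "mixture exp_kernel -` A \<inter> space \<pi> \<in> sets \<pi>"
  shows "emeasure (induced_prior exp_kernel Rpos \<pi>) A = emeasure \<pi> (mixture exp_kernel -` A \<inter> space \<pi>)"
proof -
  let ?G = "{A. A \<subseteq> densities Rpos \<and> mixture exp_kernel -` A \<inter> space \<pi> \<in> sets \<pi>}"
  have "mixture exp_kernel \<in> measurable \<pi> (sigma (densities Rpos) ?G)"
    by (rule measurable_measure_of) (auto simp: space_prior[OF \<pi>] mixture_density)
  moreover have "A \<in> sets (sigma (densities Rpos) ?G)"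
    using A sets by (subst sets_measure_of) (auto intro: sigma_sets.Basic)
  ultimately show ?thesis
    unfolding induced_prior_def by (rule emeasure_distr)
qed

text \<open>It suffices to bound the positive part, since the negative part only decreases the
  divergence.\<close>

lemma kl_div_mixture_le:
  assumes P: "P \<in> prob_measures Rpos"
    and h: "integrable (restrict_space lborel Rpos) h" "\<And>x. 0 < x \<Longrightarrow> 0 \<le> h x"
    and le: "\<And>x. 0 < x \<Longrightarrow> f0 x * ln (f0 x / mixture exp_kernel P x) \<le> h x"
  shows "kl_div Rpos f0 (mixture exp_kernel P) \<le> ereal (\<integral>x. h x \<partial>restrict_space lborel Rpos)"
proof -
  let ?L = "restrict_space lborel Rpos"
  have "(\<integral>\<^sup>+x. ennreal (f0 x * ln (f0 x / mixture exp_kernel P x)) \<partial>?L) \<le> (\<integral>\<^sup>+x. ennreal (h x) \<partial>?L)"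
    by (intro nn_integral_mono ennreal_leI le) (simp add: space_restrict_space)
  also have "\<dots> = ennreal (\<integral>x. h x \<partial>?L)"
    by (intro nn_integral_eq_integral h(1) AE_I2) (auto simp: space_restrict_space h(2))
  finally have "enn2ereal (\<integral>\<^sup>+x. ennreal (f0 x * ln (f0 x / mixture exp_kernel P x)) \<partial>?L)
      \<le> enn2ereal (ennreal (\<integral>x. h x \<partial>?L))"
    by (simp add: less_eq_ennreal.rep_eq)
  also have "enn2ereal (ennreal (\<integral>x. h x \<partial>?L)) = ereal (\<integral>x. h x \<partial>?L)"
    by (intro enn2ereal_ennreal Bochner_Integration.integral_nonneg) (auto simp: space_restrict_space h(2))
  finally show ?thesis
    unfolding kl_div_mixture[OF P]
    by (intro order_trans[OF ereal_diff_le_self]) auto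
qed

lemma integral_outside_compact_tendsto_0:
  assumes "integrable (restrict_space lborel Rpos) h"
  shows "(\<lambda>n. \<integral>x. indicator (- {1 / real (Suc n)..real (Suc n)}) x * h x \<partial>restrict_space lborel Rpos)
    \<longlonglongrightarrow> (0 :: real)"
proof -
  let ?L = "restrict_space lborel Rpos"
  let ?I = "\<lambda>n. - {1 / real (Suc n)..real (Suc n)}"
  have "(\<lambda>n. \<integral>x. indicator (?I n) x * h x \<partial>?L) \<longlonglongrightarrow> (\<integral>x. 0 \<partial>?L)"
  proof (rule integral_dominated_convergence[where w = "\<lambda>x. \<bar>h x\<bar>"])
    show "integrable ?L (\<lambda>x. \<bar>h x\<bar>)"
      using assms by simp
    show "(\<lambda>x. indicator (?I n) x * h x) \<in> borel_measurable ?L" for n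
    proof (rule borel_measurable_times)
      show "(indicator (?I n) :: real \<Rightarrow> real) \<in> borel_measurable ?L"
        unfolding measurable_restrict_lborel by (rule measurable_restrict_space1) simp
    qed (use assms in simp)
    show "AE x in ?L. norm (indicator (?I n) x * h x) \<le> \<bar>h x\<bar>" for n
      by (intro AE_I2) (simp split: split_indicator)
    show "AE x in ?L. (\<lambda>n. indicator (?I n) x * h x) \<longlonglongrightarrow> 0"
    proof (rule AE_I2)
      fix x assume "x \<in> space ?L"
      then have x: "0 < x"
        by (simp add: space_restrict_space)
      obtain N where N: "max x (1 / x) \<le> real N"
        using real_arch_simple by blast
      have "indicator (?I n) x * h x = 0" if "N \<le> n" for n
      proof -
        have "x \<le> real (Suc n)" "1 / x \<le> real (Suc n)"
          using N that by linarith+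
        then have "x \<in> {1 / real (Suc n)..real (Suc n)}"
          using x by (simp add: field_simps)
        then show ?thesis by simp
      qed
      then show "(\<lambda>n. indicator (?I n) x * h x) \<longlonglongrightarrow> 0"
        by (intro tendsto_eventually) (auto simp: eventually_sequentially)
    qed
  qed simp
  then show ?thesis by simp
qed

text \<open>A weak neighbourhood controls the mixture at finitely many points only. All mixtures are
  decreasing, so the value at \<open>x\<close> is at least the value at the next grid point, and a grid that
  is fine for the uniformly continuous function \<open>ln (mixture exp_kernel Q)\<close> loses a factor
  \<open>q\<close> there; a second factor \<open>q\<close> is lost in the neighbourhood.\<close>

lemma mixture_weak_lower_semicontinuous:
  assumes Q: "Q \<in> prob_measures Rpos" and a: "0 < a" and r: "r < 1"
  obtains U where "openin (weak_topology Rpos) U" "Q \<in> U"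
    and "\<And>P x. P \<in> U \<Longrightarrow> x \<in> {a..b} \<Longrightarrow> r * mixture exp_kernel Q x \<le> mixture exp_kernel P x"
proof -
  \<comment> \<open>The hypothesis on \<open>r\<close> allows values that are not positive, which have no logarithm.\<close>
  define s where "s = max r (1 / 2)"
  have s: "0 < s" "s < 1" "r \<le> s"
    using r by (auto simp: s_def)
  define f where "f = mixture exp_kernel Q"
  define q where "q = sqrt s"
  have q: "0 < q" "q < 1" "q * q = s"
    using s by (auto simp: q_def)
  have f_pos: "0 < f x" if "0 < x" for x
    unfolding f_def by (rule mixture_pos[OF Q that])
  have "continuous_on {a..b + 1} (\<lambda>x. ln (f x))"
  proof (rule continuous_on_ln)
    show "continuous_on {a..b + 1} f"
      unfolding f_def using a by (intro continuous_on_subset[OF continuous_on_mixture[OF Q]]) auto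
    show "\<forall>x\<in>{a..b + 1}. f x \<noteq> 0"
    proof
      fix x assume "x \<in> {a..b + 1}"
      then show "f x \<noteq> 0"
        using f_pos[of x] a by simp
    qed
  qed
  then have "uniformly_continuous_on {a..b + 1} (\<lambda>x. ln (f x))"
    by (rule compact_uniformly_continuous) simp
  moreover have "0 < - ln q"
    using q by simp
  ultimately obtain d where d: "0 < d"
    and unif: "\<And>x y. x \<in> {a..b + 1} \<Longrightarrow> y \<in> {a..b + 1} \<Longrightarrow> dist y x < d \<Longrightarrow> dist (ln (f y)) (ln (f x)) < - ln q"
    unfolding uniformly_continuous_on_def by metis
  define e where "e = min 1 (d / 2)"
  have e: "0 < e" "e \<le> 1" "e < d"
    using d by (auto simp: e_def)
  \<comment> \<open>The last grid point may lie beyond \<open>b\<close>, by less than \<open>e \<le> 1\<close>; hence the interval up to \<open>b + 1\<close> above.\<close>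
  define G where "G = (\<lambda>i. a + real i * e) ` {..nat \<lceil>(b - a) / e\<rceil>}"
  have G: "finite G" "G \<noteq> {}" "\<And>y. y \<in> G \<Longrightarrow> 0 < y"
    using a e by (auto simp: G_def intro!: add_pos_nonneg)
  define U where "U = (\<Inter>y\<in>G. {P \<in> prob_measures Rpos. q * f y < mixture exp_kernel P y})"
  show thesis
  proof
    show "openin (weak_topology Rpos) U"
      unfolding U_def using G by (intro openin_INT2 openin_mixture_gt) auto
    show "Q \<in> U"
      using Q q G(3) f_pos by (auto simp: U_def f_def)
    fix P x assume PU: "P \<in> U" and x: "x \<in> {a..b}"
    have P: "P \<in> prob_measures Rpos"
      using PU G(2) by (auto simp: U_def)
    define i where "i = nat \<lceil>(x - a) / e\<rceil>"
    define y where "y = a + real i * e"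
    have "real i = of_int \<lceil>(x - a) / e\<rceil>"
      using x e by (simp add: i_def)
    then have "(x - a) / e \<le> real i" "real i < (x - a) / e + 1"
      by linarith+
    then have y: "x \<le> y" "y < x + e"
      using e by (simp_all add: y_def field_simps)
    have "(x - a) / e \<le> (b - a) / e"
      using x e by (intro divide_right_mono) auto
    then have "i \<le> nat \<lceil>(b - a) / e\<rceil>"
      unfolding i_def by (intro nat_mono ceiling_mono)
    then have "y \<in> G"
      by (auto simp: G_def y_def)
    have "dist (ln (f y)) (ln (f x)) < - ln q"
      using x y e by (intro unif) (auto simp: dist_real_def)
    then have "ln (q * f x) < ln (f y)"
      using q f_pos[of x] x a by (simp add: ln_mult dist_real_def)
    then have qf: "q * f x \<le> f y"
      using q f_pos[of x] f_pos[of y] x y a by simp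
    have "r * f x \<le> q * (q * f x)"
      using s(3) q(3) f_pos[of x] x a by (simp flip: mult.assoc)
    also have "\<dots> \<le> q * f y"
      using qf q by simp
    also have "\<dots> \<le> mixture exp_kernel P y"
      using PU \<open>y \<in> G\<close> by (auto simp: U_def less_imp_le)
    also have "\<dots> \<le> mixture exp_kernel P x"
      using x y a by (intro mixture_antimono[OF P]) auto
    finally show "r * mixture exp_kernel Q x \<le> mixture exp_kernel P x"
      by (simp add: f_def)
  qed
qed

text \<open>Near \<open>Q\<close> the integrand is at most \<open>\<epsilon> / 4 * f0\<close> on a compact interval \<open>[1 / (n + 1), n + 1]\<close>, by the
  grid argument and the domination of \<open>f0\<close> by \<open>Q\<close>. Everywhere, and uniformly in the
  neighbourhood, it is at most the integrable function \<open>h\<close>, because \<open>mixture_lower_bound\<close> makes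
  \<open>- ln\<close> of the mixture grow at most linearly; the interval is chosen to leave little of \<open>h\<close>
  outside.\<close>

lemma kl_div_small_near_dominating_mixture:
  assumes f0: "f0 \<in> densities Rpos"
    and int_x: "density_integrable Rpos f0 (\<lambda>x. x)"
    and int_ln: "density_integrable Rpos f0 (\<lambda>x. \<bar>ln (f0 x)\<bar>)"
    and \<epsilon>: "0 < \<epsilon>"
    and Q: "Q \<in> prob_measures Rpos"
    and dom: "\<And>x. 0 < x \<Longrightarrow> f0 x \<le> exp (\<epsilon> / 8) * mixture exp_kernel Q x"
  obtains U where "openin (weak_topology Rpos) U" "Q \<in> U"
    and "\<And>P. P \<in> U \<Longrightarrow> kl_div Rpos f0 (mixture exp_kernel P) < ereal \<epsilon>"
proof -
  let ?L = "restrict_space lborel Rpos"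
  have f0_nonneg: "0 \<le> f0 x" if "0 < x" for x
    using f0 that by (simp add: densities_def)
  have int_f0: "integrable ?L f0"
    by (rule density_integrable_lborel[OF f0])
  have mass: "(\<integral>x. f0 x \<partial>?L) = 1"
    using f0 by (subst integral_eq_nn_integral)
      (auto simp: densities_def space_restrict_space intro!: AE_I2)
  define c where "c = mixture exp_kernel Q 1 / 2"
  have c: "0 < c" "c < mixture exp_kernel Q 1"
    using mixture_pos[OF Q, of 1] by (auto simp: c_def)
  define h where "h x = \<bar>ln (f0 x)\<bar> * f0 x + \<bar>ln c\<bar> * f0 x + 2 / c * (\<bar>x\<bar> * f0 x)" for x
  have int_h: "integrable ?L h"
    unfolding h_def using int_x int_ln int_f0
    by (intro Bochner_Integration.integrable_add integrable_mult_right)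
      (simp_all add: density_integrable_def)
  have h_nonneg: "0 \<le> h x" if "0 < x" for x
    using f0_nonneg[OF that] c by (simp add: h_def)
  have "\<forall>\<^sub>F n in sequentially.
      (\<integral>x. indicator (- {1 / real (Suc n)..real (Suc n)}) x * h x \<partial>?L) < \<epsilon> / 2"
    using order_tendstoD(2)[OF integral_outside_compact_tendsto_0[OF int_h], of "\<epsilon> / 2"] \<epsilon> by simp
  then obtain n where tail:
    "(\<integral>x. indicator (- {1 / real (Suc n)..real (Suc n)}) x * h x \<partial>?L) < \<epsilon> / 2"
    by (auto simp: eventually_sequentially)
  let ?I = "{1 / real (Suc n)..real (Suc n)}"
  obtain V where V: "openin (weak_topology Rpos) V" "Q \<in> V"
    and lower: "\<And>P x. P \<in> V \<Longrightarrow> x \<in> ?I \<Longrightarrow>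
      exp (- (\<epsilon> / 8)) * mixture exp_kernel Q x \<le> mixture exp_kernel P x"
    using mixture_weak_lower_semicontinuous[OF Q, of "1 / real (Suc n)" "exp (- (\<epsilon> / 8))" "real (Suc n)"] \<epsilon>
    by auto
  define U where "U = V \<inter> {P \<in> prob_measures Rpos. c < mixture exp_kernel P 1}"
  show thesis
  proof
    show "openin (weak_topology Rpos) U"
      unfolding U_def by (intro openin_Int V openin_mixture_gt) simp
    show "Q \<in> U"
      using Q V c by (simp add: U_def)
    fix P assume "P \<in> U"
    then have P: "P \<in> prob_measures Rpos" and PV: "P \<in> V" and Pc: "c < mixture exp_kernel P 1"
      by (auto simp: U_def)
    let ?g = "\<lambda>x. \<epsilon> / 4 * f0 x + indicator (- ?I) x * h x"
    have int_tail: "integrable ?L (\<lambda>x. indicator (- ?I) x * h x)"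
    proof (rule Bochner_Integration.integrable_bound[OF int_h])
      have "(indicator (- ?I) :: real \<Rightarrow> real) \<in> borel_measurable ?L"
        unfolding measurable_restrict_lborel by (rule measurable_restrict_space1) simp
      then show "(\<lambda>x. indicator (- ?I) x * h x) \<in> borel_measurable ?L"
        using int_h by (intro borel_measurable_times) simp_all
    qed (intro AE_I2, simp split: split_indicator)
    have "kl_div Rpos f0 (mixture exp_kernel P) \<le> ereal (\<integral>x. ?g x \<partial>?L)"
    proof (rule kl_div_mixture_le[OF P])
      show "integrable ?L ?g"
        by (intro Bochner_Integration.integrable_add integrable_mult_right int_f0 int_tail)
      fix x :: real assume x: "0 < x"
      show "0 \<le> ?g x"
        using f0_nonneg[OF x] h_nonneg[OF x] \<epsilon> by simp
      show "f0 x * ln (f0 x / mixture exp_kernel P x) \<le> ?g x"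
      proof (cases "f0 x = 0")
        case True
        then show ?thesis
          using h_nonneg[OF x] by simp
      next
        case False
        with f0_nonneg[OF x] have f0x: "0 < f0 x" by simp
        note Px = mixture_pos[OF P x]
        show ?thesis
        proof (cases "x \<in> ?I")
          case True
          have "f0 x \<le> exp (\<epsilon> / 8) * mixture exp_kernel Q x"
            by (rule dom[OF x])
          also have "\<dots> = exp (\<epsilon> / 4) * (exp (- (\<epsilon> / 8)) * mixture exp_kernel Q x)"
            by (simp flip: exp_add mult.assoc)
          also have "\<dots> \<le> exp (\<epsilon> / 4) * mixture exp_kernel P x"
            by (intro mult_left_mono lower[OF PV True]) simp
          finally have "f0 x / mixture exp_kernel P x \<le> exp (\<epsilon> / 4)"
            using Px by (simp add: field_simps)
          then have "ln (f0 x / mixture exp_kernel P x) \<le> ln (exp (\<epsilon> / 4))"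
            using f0x Px by (subst ln_le_cancel_iff) simp_all
          then have "ln (f0 x / mixture exp_kernel P x) \<le> \<epsilon> / 4"
            by simp
          then show ?thesis
            using f0x True by (simp add: mult.commute)
        next
          case False
          let ?W = "mixture exp_kernel P 1"
          \<comment> \<open>The lower bound increases with its parameter, so \<open>c < ?W\<close> makes it independent of \<open>P\<close>.\<close>
          have "c * exp (- (2 / c) * x) \<le> ?W * exp (- (2 / ?W) * x)"
            using c Pc x by (intro mult_mono) (auto intro!: mult_right_mono divide_left_mono)
          also have "\<dots> \<le> mixture exp_kernel P x"
            by (rule mixture_lower_bound[OF P x])
          finally have "ln (c * exp (- (2 / c) * x)) \<le> ln (mixture exp_kernel P x)"
            using c Px by simp
          then have "ln c - 2 / c * x \<le> ln (mixture exp_kernel P x)"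
            using c by (simp add: ln_mult)
          then have "ln (f0 x / mixture exp_kernel P x) \<le> \<bar>ln (f0 x)\<bar> + \<bar>ln c\<bar> + 2 / c * x"
            using f0x Px by (simp add: ln_div)
          then have "f0 x * ln (f0 x / mixture exp_kernel P x) \<le> f0 x * (\<bar>ln (f0 x)\<bar> + \<bar>ln c\<bar> + 2 / c * x)"
            using f0x by simp
          also have "\<dots> = h x"
            using x by (simp add: h_def algebra_simps)
          finally have "f0 x * ln (f0 x / mixture exp_kernel P x) \<le> h x" .
          moreover have "?g x = \<epsilon> / 4 * f0 x + h x" "0 \<le> \<epsilon> / 4 * f0 x"
            using False \<epsilon> f0x by simp_all
          ultimately show ?thesis
            by linarith
        qed
      qed
    qed
    also have "(\<integral>x. ?g x \<partial>?L) = \<epsilon> / 4 + (\<integral>x. indicator (- ?I) x * h x \<partial>?L)"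
      using int_f0 int_tail mass by (subst Bochner_Integration.integral_add) auto
    also have "ereal \<dots> < ereal \<epsilon>"
      using tail \<epsilon> by simp
    finally show "kl_div Rpos f0 (mixture exp_kernel P) < ereal \<epsilon>" .
  qed
qed

theorem theorem16:
  fixes \<pi> :: "real measure measure" and f0 :: "real \<Rightarrow> real"
  assumes "prior_on Rpos \<pi>"
    and "f0 \<in> densities Rpos"
    and "continuous_on Rpos f0"
    and "density_integrable Rpos f0 (\<lambda>x. x)"
    and "density_integrable Rpos f0 (\<lambda>x. \<bar>ln (f0 x)\<bar>)"
    and "completely_monotone (\<lambda>x. 1 - distribution_function f0 x)"
    and "weak_support Rpos \<pi> = prob_measures Rpos"
  shows "f0 \<in> KL Rpos (induced_prior exp_kernel Rpos \<pi>)"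
proof -
  let ?\<phi> = "\<lambda>x. 1 - distribution_function f0 x"
  note \<pi> = assms(1) and f0 = assms(2) and cm = assms(6)
  have deriv: "alt_deriv ?\<phi> 1 x = f0 x" if "0 < x" for x
    using alt_deriv_survival_function[OF f0 assms(3) that] .
  have "(\<integral>\<^sup>+x. ennreal (alt_deriv ?\<phi> 1 x) \<partial>restrict_space lborel Rpos)
      = (\<integral>\<^sup>+x. ennreal (f0 x) \<partial>restrict_space lborel Rpos)"
    by (intro nn_integral_cong) (simp add: deriv[simplified] space_restrict_space)
  then have mass: "(\<integral>\<^sup>+x. ennreal (alt_deriv ?\<phi> 1 x) \<partial>restrict_space lborel Rpos) = 1"
    using f0 by (simp add: densities_def)
  have "0 < emeasure (induced_prior exp_kernel Rpos \<pi>)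
      {f \<in> space (induced_prior exp_kernel Rpos \<pi>). kl_div Rpos f0 f < ereal \<epsilon>}"
    if \<epsilon>: "0 < \<epsilon>" for \<epsilon>
  proof -
    \<comment> \<open>Large enough that the loss \<open>1 + 1 / n\<close> is at most \<open>exp (\<epsilon> / 8)\<close>.\<close>
    obtain n :: nat where n: "8 / \<epsilon> \<le> real n"
      using real_arch_simple by blast
    moreover have "0 < 8 / \<epsilon>"
      using \<epsilon> by simp
    ultimately have n_pos: "0 < n"
      by linarith
    obtain Q where Q: "Q \<in> prob_measures Rpos"
      and Q_dom: "\<And>x. 0 < x \<Longrightarrow> alt_deriv ?\<phi> 1 x \<le> (1 + 1 / n) * mixture exp_kernel Q x"
      using exists_mixture_dominating[OF cm mass n_pos] by blast
    have "1 + 1 / n \<le> 1 + \<epsilon> / 8"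
      using n n_pos \<epsilon> by (simp add: field_simps)
    also have "\<dots> \<le> exp (\<epsilon> / 8)"
      by (rule exp_ge_add_one_self)
    finally have exp: "1 + 1 / n \<le> exp (\<epsilon> / 8)" .
    have dom: "f0 x \<le> exp (\<epsilon> / 8) * mixture exp_kernel Q x" if x: "0 < x" for x
      using Q_dom[OF x] mult_right_mono[OF exp less_imp_le[OF mixture_pos[OF Q x]]] deriv[OF x]
      by linarith
    obtain U where U: "openin (weak_topology Rpos) U" "Q \<in> U"
      and kl: "\<And>P. P \<in> U \<Longrightarrow> kl_div Rpos f0 (mixture exp_kernel P) < ereal \<epsilon>"
      using kl_div_small_near_dominating_mixture[OF f0 assms(4,5) \<epsilon> Q dom] by blast
    let ?A = "{f \<in> densities Rpos. kl_div Rpos f0 f < ereal \<epsilon>}"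
    have vimage: "mixture exp_kernel -` ?A \<inter> space \<pi> =
        {P \<in> space \<pi>. kl_div Rpos f0 (mixture exp_kernel P) < ereal \<epsilon>}"
      by (auto simp: space_prior[OF \<pi>] mixture_density)
    have sets: "{P \<in> space \<pi>. kl_div Rpos f0 (mixture exp_kernel P) < ereal \<epsilon>} \<in> sets \<pi>"
      using f0 by (intro sets_kl_div_mixture_less[OF \<pi>]) (simp add: densities_def)
    have "0 < emeasure \<pi> U"
      using Q U assms(7) by (auto simp: weak_support_def)
    also have "\<dots> \<le> emeasure \<pi> {P \<in> space \<pi>. kl_div Rpos f0 (mixture exp_kernel P) < ereal \<epsilon>}"
      using openin_weak_topology_subset[OF U(1)] kl
      by (intro emeasure_mono sets) (auto simp: space_prior[OF \<pi>])
    also have "\<dots> = emeasure (induced_prior exp_kernel Rpos \<pi>) ?A"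
      using emeasure_induced_prior[OF \<pi>, of ?A] sets unfolding vimage by auto
    also have "?A = {f \<in> space (induced_prior exp_kernel Rpos \<pi>). kl_div Rpos f0 f < ereal \<epsilon>}"
      by (simp add: induced_prior_def space_measure_of_conv)
    finally show ?thesis .
  qed
  then show ?thesis
    by (simp add: KL_def)
qed

end
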